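(* Let $A\in\mathbb{R}^{m\times n}$ with $m\ge n$ have full rank and nonzero rows, and let $q\ge 1$ be an integer. Consider randomized Kaczmarz with averaging over $q$ threads with probabilities $p_i=\frac{\|A_i\|^2}{\|A\|_F^2}$ and weight matrix $W=\alpha I$. The relaxation parameter $\alpha>0$ which yields the fastest convergence rate guarantee, i.e. which minimizes over $\alpha>0$ the rate constant $$\rho(\alpha)=\sigma_{\max}\left(\left(I-\alpha\frac{A^\top A}{\|A\|_F^2}\right)^2+\frac{\alpha^2}{q}\left(I-\frac{A^\top A}{\|A\|_F^2}\right)\frac{A^\top A}{\|A\|_F^2}\right),$$ is $$\alpha^\star=\begin{cases}\dfrac{q}{1+(q-1)s_{\min}}, & 1-(q-1)(s_{\max}-s_{\min})\ge 0,\\[2ex] \dfrac{2q}{1+(q-1)(s_{\min}+s_{\max})}, & 1-(q-1)(s_{\max}-s_{\min})<0,\end{cases}$$ where $s_{\min}=\frac{\sigma_{\min}^2(A)}{\|A\|_F^2}$ and $s_{\max}=\frac{\sigma_{\max}^2(A)}{\|A\|_F^2}$.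
   Context: $A_i$ denotes the $i$-th row of $A$, $\|\cdot\|$ the Euclidean norm, $\|A\|_F^2=\sum_{i,j}A_{ij}^2$, $I$ the identity matrix, $\sigma_{\max}(\cdot)$ the largest singular value, and $\sigma_{\min}(A)$ the smallest nonzero singular value of $A$ (which, $A$ having full rank with $m\ge n$, is the smallest of its $n$ singular values). Background: randomized Kaczmarz with averaging for a system $Ax=b$ with $W=\alpha I$ is the iteration $x^{k+1}=x^k-\frac{\alpha}{q}\sum_{i\in\tau_k}\frac{A_ix^k-b_i}{\|A_i\|^2}A_i^\top$, where $\tau_k$ consists of $q$ indices drawn independently with replacement with $\mathbb{P}(i=j)=p_j$. With $x^\star$ the least-squares solution, $e^k=x^k-x^\star$ and $r^\star=b-Ax^\star$, the convergence rate guarantee referred to is the bound $\mathbb{E}[\|e^{k+1}\|^2\mid e^k]\le\rho(\alpha)\|e^k\|^2+\frac{\alpha^2\|r^\star\|^2}{q\|A\|_F^2}$, whose rate constant is $\rho(\alpha)$. *)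

theory Defs
  imports "HOL-Analysis.Analysis"
begin

definition frob_norm :: "real^'n^'m \<Rightarrow> real"
  where "frob_norm A = sqrt (\<Sum>i\<in>UNIV. \<Sum>j\<in>UNIV. (A $ i $ j)\<^sup>2)"

text \<open>
  The singular values of A are the square roots of the eigenvalues of the Gram matrix
  \<open>A\<^sup>T A\<close>. For a wide matrix this set always contains 0, also when the rank is maximal; neither the
  largest nor the smallest nonzero singular value depends on that.
\<close>

definition singular_values :: "real^'n^'m \<Rightarrow> real set"
  where "singular_values A =
    {s. 0 \<le> s \<and> (\<exists>v. v \<noteq> 0 \<and> (transpose A ** A) *v v = s\<^sup>2 *\<^sub>R v)}"

definition sigma_max :: "real^'n^'m \<Rightarrow> real"
  where "sigma_max A = Max (singular_values A)"

definition sigma_min :: "real^'n^'m \<Rightarrow> real"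
  where "sigma_min A = Min (singular_values A - {0})"

definition normalized_gram :: "real^'n^'m \<Rightarrow> real^'n^'n"
  where "normalized_gram A = (1 / (frob_norm A)\<^sup>2) *\<^sub>R (transpose A ** A)"

text \<open>
  The constant in the bound
  \<open>E[\<parallel>e\<^sub>k\<^sub>+\<^sub>1\<parallel>\<^sup>2 | e\<^sub>k] \<le> \<rho>(\<alpha>) \<parallel>e\<^sub>k\<parallel>\<^sup>2 + \<alpha>\<^sup>2 \<parallel>r\<parallel>\<^sup>2 / (q \<parallel>A\<parallel>\<^sub>F\<^sup>2)\<close>, with \<open>r\<close> the least-squares residual, for
  randomized Kaczmarz with averaging over \<open>q\<close> threads, row probabilities
  \<open>p\<^sub>i = \<parallel>A\<^sub>i\<parallel>\<^sup>2 / \<parallel>A\<parallel>\<^sub>F\<^sup>2\<close> and weight matrix \<open>W = \<alpha> I\<close>.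
\<close>

definition rka_rate :: "real^'n^'m \<Rightarrow> nat \<Rightarrow> real \<Rightarrow> real"
  where "rka_rate A q \<alpha> =
    (let G = normalized_gram A;
         M = mat 1 - \<alpha> *\<^sub>R G
     in sigma_max (M ** M + (\<alpha>\<^sup>2 / real q) *\<^sub>R ((mat 1 - G) ** G)))"

definition s_min :: "real^'n^'m \<Rightarrow> real"
  where "s_min A = (sigma_min A)\<^sup>2 / (frob_norm A)\<^sup>2"

definition s_max :: "real^'n^'m \<Rightarrow> real"
  where "s_max A = (sigma_max A)\<^sup>2 / (frob_norm A)\<^sup>2"

end

theory Submission
  imports Defs
begin

text \<open>
  The matrix inside \<open>\<rho>(\<alpha>)\<close> is a polynomial in the symmetric matrix \<open>G = A\<^sup>T A / \<parallel>A\<parallel>\<^sub>F\<^sup>2\<close>, whose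
  eigenvalues lie in \<open>[0, 1]\<close>. On an eigenvalue \<open>s\<close> of \<open>G\<close> this polynomial has the nonnegative value
  \<open>h\<^sub>s(\<alpha>) = (1 - \<alpha> s)\<^sup>2 + \<alpha>\<^sup>2 (1 - s) s / q\<close>, so \<open>\<rho>(\<alpha>)\<close> is the maximum of \<open>h\<^sub>s(\<alpha>)\<close> over the spectrum.
  As \<open>h\<^sub>s(\<alpha>)\<close> is convex in \<open>s\<close>, only \<open>s = s\<^sub>m\<^sub>i\<^sub>n\<close> and \<open>s = s\<^sub>m\<^sub>a\<^sub>x\<close> matter. In \<open>\<alpha>\<close>, \<open>h\<^sub>s\<close> is a parabola
  with vertex \<open>v\<^sub>s = q / (1 + (q - 1) s)\<close>, and the two extreme parabolas cross at
  \<open>c = 2 q / (1 + (q - 1) (s\<^sub>m\<^sub>i\<^sub>n + s\<^sub>m\<^sub>a\<^sub>x))\<close>. The one for \<open>s\<^sub>m\<^sub>a\<^sub>x\<close> is the lower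
  one before \<open>c\<close> and increases after it, so the maximum is smallest at the vertex for \<open>s\<^sub>m\<^sub>i\<^sub>n\<close> if this
  comes before \<open>c\<close>, and at \<open>c\<close> otherwise.
\<close>

section \<open>Eigenvalues of self-adjoint operators\<close>

definition selfadjoint :: "('a::real_inner \<Rightarrow> 'a) \<Rightarrow> bool"
  where "selfadjoint f \<longleftrightarrow> linear f \<and> (\<forall>x y. f x \<bullet> y = x \<bullet> f y)"

definition eigenvalues :: "('a::real_vector \<Rightarrow> 'a) \<Rightarrow> real set"
  where "eigenvalues f = {\<mu>. \<exists>v. v \<noteq> 0 \<and> f v = \<mu> *\<^sub>R v}"

lemma linear_coeff_eq_0_if_quadratic_nonneg:
  fixes a b :: real
  assumes "\<And>t. 0 \<le> a * t + b * t\<^sup>2"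
  shows "a = 0"
proof (rule DERIV_local_min)
  show "((\<lambda>t. a * t + b * t\<^sup>2) has_real_derivative a) (at 0)"
    by (auto intro!: derivative_eq_intros)
  show "\<forall>t. \<bar>0 - t\<bar> < 1 \<longrightarrow> a * 0 + b * 0\<^sup>2 \<le> a * t + b * t\<^sup>2"
    using assms by simp
qed simp

lemma selfadjoint_semidefinite_isotropic_imp_kernel:
  assumes "selfadjoint f" "subspace S" "f ` S \<subseteq> S"
    and nonneg: "\<And>x. x \<in> S \<Longrightarrow> 0 \<le> x \<bullet> f x"
    and "v \<in> S" "v \<bullet> f v = 0"
  shows "f v = 0"
proof -
  have "linear f" and sym: "v \<bullet> f (f v) = f v \<bullet> f v"
    using assms(1) by (simp_all add: selfadjoint_def)
  have "0 \<le> 2 * (f v \<bullet> f v) * t + (f v \<bullet> f (f v)) * t\<^sup>2" for t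
  proof -
    have "v + t *\<^sub>R f v \<in> S"
      using assms(2,3,5) by (intro subspace_add subspace_scale) auto
    then have "0 \<le> (v + t *\<^sub>R f v) \<bullet> f (v + t *\<^sub>R f v)"
      by (rule nonneg)
    also have "\<dots> = 2 * (f v \<bullet> f v) * t + (f v \<bullet> f (f v)) * t\<^sup>2"
      using sym assms(6) \<open>linear f\<close>
      by (simp add: linear_add linear_cmul inner_add_left inner_add_right power2_eq_square)
    finally show ?thesis .
  qed
  then have "2 * (f v \<bullet> f v) = 0"
    by (rule linear_coeff_eq_0_if_quadratic_nonneg)
  then show ?thesis by simp
qed

lemma Rayleigh_quotient_attains_max:
  fixes f :: "'a::euclidean_space \<Rightarrow> 'a"
  assumes "linear f" "subspace S" "S \<noteq> {0}"
  obtains v where "v \<in> S" "norm v = 1" "\<And>x. x \<in> S \<Longrightarrow> x \<bullet> f x \<le> (v \<bullet> f v) * (x \<bullet> x)"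
proof -
  let ?K = "S \<inter> sphere 0 1"
  have normalize: "x /\<^sub>R norm x \<in> ?K" if "x \<in> S" "x \<noteq> 0" for x
    using that \<open>subspace S\<close> by (simp add: subspace_scale)
  have "compact ?K"
    using closed_subspace[OF \<open>subspace S\<close>] by (simp add: closed_Int_compact)
  moreover have "?K \<noteq> {}"
    using normalize subspace_0[OF \<open>subspace S\<close>] \<open>S \<noteq> {0}\<close> by blast
  moreover have "continuous_on ?K (\<lambda>x. x \<bullet> f x)"
    using \<open>linear f\<close>
    by (intro continuous_on_inner continuous_on_id linear_continuous_on) (simp add: linear_linear)
  ultimately have "\<exists>v\<in>?K. \<forall>x\<in>?K. x \<bullet> f x \<le> v \<bullet> f v"
    by (rule continuous_attains_sup)
  then obtain v where v: "v \<in> ?K" and max: "\<forall>x\<in>?K. x \<bullet> f x \<le> v \<bullet> f v"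
    by (rule bexE)
  have "x \<bullet> f x \<le> (v \<bullet> f v) * (x \<bullet> x)" if "x \<in> S" for x
  proof (cases "x = 0")
    case False
    from bspec[OF max normalize[OF that this]] have "(x \<bullet> f x) / (norm x)\<^sup>2 \<le> v \<bullet> f v"
      using \<open>linear f\<close> by (simp add: linear_cmul power2_eq_square field_simps)
    then show ?thesis
      using False by (simp add: divide_le_eq power2_norm_eq_inner)
  qed simp
  with v that show thesis by auto
qed

text \<open>
  At a maximiser \<open>v\<close> of the Rayleigh quotient, with value \<open>\<mu>\<close>, the positive semidefinite form
  \<open>\<mu> \<parallel>x\<parallel>\<^sup>2 - x \<bullet> f x\<close> vanishes.
\<close>

lemma selfadjoint_eigenvector_in_invariant_subspace:
  fixes f :: "'a::euclidean_space \<Rightarrow> 'a"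
  assumes "selfadjoint f" "subspace S" "f ` S \<subseteq> S" "S \<noteq> {0}"
  obtains v \<mu> where "v \<in> S" "v \<noteq> 0" "f v = \<mu> *\<^sub>R v"
proof -
  have "linear f" using assms(1) by (simp add: selfadjoint_def)
  then obtain v where v: "v \<in> S" "norm v = 1"
    and max: "\<And>x. x \<in> S \<Longrightarrow> x \<bullet> f x \<le> (v \<bullet> f v) * (x \<bullet> x)"
    using Rayleigh_quotient_attains_max assms(2,4) by blast
  define g where "g x = (v \<bullet> f v) *\<^sub>R x - f x" for x
  have "g v = 0"
  proof (rule selfadjoint_semidefinite_isotropic_imp_kernel[of g S v])
    have "linear g"
      unfolding g_def using \<open>linear f\<close> by (intro linear_compose_sub linear_scale_self)
    then show "selfadjoint g"
      using assms(1) by (simp add: selfadjoint_def g_def inner_diff_left inner_diff_right)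
    show "g ` S \<subseteq> S"
      using assms(2,3) by (auto simp: g_def intro!: subspace_diff subspace_scale)
    show "0 \<le> x \<bullet> g x" if "x \<in> S" for x
      using max[OF that] by (simp add: g_def inner_diff_right)
    show "v \<bullet> g v = 0"
      using v(2) by (simp add: g_def inner_diff_right norm_eq_1)
  qed fact+
  then have "f v = (v \<bullet> f v) *\<^sub>R v" by (simp add: g_def)
  with v that show thesis by force
qed

lemma eigenvalues_selfadjoint_nonempty:
  fixes f :: "'a::euclidean_space \<Rightarrow> 'a"
  assumes "selfadjoint f"
  shows "eigenvalues f \<noteq> {}"
proof -
  have "(UNIV :: 'a set) \<noteq> {0}"
    using nonzero_Basis[OF SOME_Basis] by blast
  then obtain v \<mu> where "v \<noteq> 0" "f v = \<mu> *\<^sub>R v"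
    using selfadjoint_eigenvector_in_invariant_subspace[OF assms subspace_UNIV] by blast
  then show ?thesis by (auto simp: eigenvalues_def)
qed

lemma finite_eigenvalues_selfadjoint:
  fixes f :: "'a::euclidean_space \<Rightarrow> 'a"
  assumes "selfadjoint f"
  shows "finite (eigenvalues f)"
proof -
  have "\<forall>\<mu>\<in>eigenvalues f. \<exists>v. v \<noteq> 0 \<and> f v = \<mu> *\<^sub>R v"
    by (simp add: eigenvalues_def)
  then obtain v where v: "\<And>\<mu>. \<mu> \<in> eigenvalues f \<Longrightarrow> v \<mu> \<noteq> 0 \<and> f (v \<mu>) = \<mu> *\<^sub>R v \<mu>"
    by metis
  have orthogonal: "v \<mu> \<bullet> v \<nu> = 0"
    if "\<mu> \<in> eigenvalues f" "\<nu> \<in> eigenvalues f" "\<mu> \<noteq> \<nu>" for \<mu> \<nu>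
  proof -
    have "f (v \<mu>) \<bullet> v \<nu> = v \<mu> \<bullet> f (v \<nu>)"
      using assms by (simp add: selfadjoint_def)
    with v[OF that(1)] v[OF that(2)] that(3) show ?thesis by simp
  qed
  have "inj_on v (eigenvalues f)"
    by (rule inj_onI) (metis orthogonal v inner_eq_zero_iff)
  moreover have "independent (v ` eigenvalues f)"
  proof (rule pairwise_orthogonal_independent)
    show "pairwise orthogonal (v ` eigenvalues f)"
      using orthogonal by (fastforce simp: pairwise_def orthogonal_def)
    show "0 \<notin> v ` eigenvalues f"
      using v by auto
  qed
  then have "finite (v ` eigenvalues f)"
    by (rule independent_imp_finite)
  ultimately show ?thesis by (simp add: finite_image_iff)
qed

text \<open>
  An eigenspace of \<open>g\<close> is invariant under \<open>f\<close>, so it contains an eigenvector of \<open>f\<close>.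
\<close>

lemma eigenvalues_function_of_selfadjoint:
  fixes f g :: "'a::euclidean_space \<Rightarrow> 'a"
  assumes "selfadjoint f" "linear g"
    and commute: "\<And>x. g (f x) = f (g x)"
    and calculus: "\<And>v \<mu>. f v = \<mu> *\<^sub>R v \<Longrightarrow> g v = \<phi> \<mu> *\<^sub>R v"
  shows "eigenvalues g = \<phi> ` eigenvalues f"
proof
  show "\<phi> ` eigenvalues f \<subseteq> eigenvalues g"
    using calculus by (auto simp: eigenvalues_def)
  show "eigenvalues g \<subseteq> \<phi> ` eigenvalues f"
  proof
    fix \<kappa> assume "\<kappa> \<in> eigenvalues g"
    let ?S = "{x. g x = \<kappa> *\<^sub>R x}"
    have "subspace ?S"
      using \<open>linear g\<close> by (simp add: subspace_def linear_0 linear_add linear_cmul scaleR_add_right)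
    moreover have "f ` ?S \<subseteq> ?S"
      using assms(1) by (auto simp: commute selfadjoint_def linear_cmul)
    moreover have "?S \<noteq> {0}"
      using \<open>\<kappa> \<in> eigenvalues g\<close> by (auto simp: eigenvalues_def)
    ultimately obtain v \<mu> where v: "v \<in> ?S" "v \<noteq> 0" "f v = \<mu> *\<^sub>R v"
      using selfadjoint_eigenvector_in_invariant_subspace[OF assms(1)] by blast
    then have "\<kappa> = \<phi> \<mu>"
      using calculus[OF v(3)] by simp
    with v show "\<kappa> \<in> \<phi> ` eigenvalues f"
      by (auto simp: eigenvalues_def)
  qed
qed

section \<open>Singular values\<close>

lemma inner_gram: "((transpose A ** A) *v x) \<bullet> y = (A *v x) \<bullet> (A *v y)"
  for A :: "real^'n^'m"
  by (simp add: dot_lmul_matrix flip: matrix_vector_mul_assoc)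

lemma selfadjoint_gram: "selfadjoint ((*v) (transpose A ** A))"
  for A :: "real^'n^'m"
  unfolding selfadjoint_def
proof (intro conjI allI matrix_vector_mul_linear)
  fix x y
  have "((transpose A ** A) *v x) \<bullet> y = ((transpose A ** A) *v y) \<bullet> x"
    unfolding inner_gram by (rule inner_commute)
  also have "\<dots> = x \<bullet> ((transpose A ** A) *v y)"
    by (rule inner_commute)
  finally show "((transpose A ** A) *v x) \<bullet> y = x \<bullet> ((transpose A ** A) *v y)" .
qed

lemma frob_norm_eq_norm: "frob_norm A = norm A"
  by (simp add: frob_norm_def norm_vec_def L2_set_def sum_nonneg)

lemma norm_matrix_vector_mult_le: "norm (A *v x) \<le> norm A * norm x"
  for A :: "real^'n^'m"
proof -
  have "norm (A *v x) = L2_set (\<lambda>i. \<bar>A $ i \<bullet> x\<bar>) UNIV"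
    by (simp add: norm_vec_def matrix_mult_dot)
  also have "\<dots> \<le> L2_set (\<lambda>i. norm (A $ i) * norm x) UNIV"
    by (intro L2_set_mono Cauchy_Schwarz_ineq2) simp
  also have "\<dots> = norm A * norm x"
    by (simp add: norm_vec_def[of A] flip: L2_set_left_distrib)
  finally show ?thesis .
qed

lemma eigenvalues_gram_subset: "eigenvalues ((*v) (transpose A ** A)) \<subseteq> {0..(norm A)\<^sup>2}"
  for A :: "real^'n^'m"
proof
  fix \<mu> assume "\<mu> \<in> eigenvalues ((*v) (transpose A ** A))"
  then obtain v where "v \<noteq> 0" and eigen: "(transpose A ** A) *v v = \<mu> *\<^sub>R v"
    by (auto simp: eigenvalues_def)
  have "\<mu> * (norm v)\<^sup>2 = (norm (A *v v))\<^sup>2"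
    using inner_gram[of A v v] by (simp add: eigen power2_norm_eq_inner)
  moreover have "(norm (A *v v))\<^sup>2 \<le> (norm A)\<^sup>2 * (norm v)\<^sup>2"
    using norm_matrix_vector_mult_le[of A v]
    by (metis norm_ge_zero power_mono power_mult_distrib)
  ultimately have "0 \<le> \<mu> * (norm v)\<^sup>2" "\<mu> * (norm v)\<^sup>2 \<le> (norm A)\<^sup>2 * (norm v)\<^sup>2"
    by simp_all
  with \<open>v \<noteq> 0\<close> show "\<mu> \<in> {0..(norm A)\<^sup>2}"
    by (simp add: zero_le_mult_iff)
qed

lemma singular_values_eq_sqrt_eigenvalues:
  fixes A :: "real^'n^'m"
  shows "singular_values A = sqrt ` eigenvalues ((*v) (transpose A ** A))"
proof
  show "singular_values A \<subseteq> sqrt ` eigenvalues ((*v) (transpose A ** A))"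
  proof
    fix s assume "s \<in> singular_values A"
    then have "s\<^sup>2 \<in> eigenvalues ((*v) (transpose A ** A))" "s = sqrt (s\<^sup>2)"
      by (auto simp: singular_values_def eigenvalues_def)
    then show "s \<in> sqrt ` eigenvalues ((*v) (transpose A ** A))" by blast
  qed
  show "sqrt ` eigenvalues ((*v) (transpose A ** A)) \<subseteq> singular_values A"
    using eigenvalues_gram_subset[of A] by (fastforce simp: singular_values_def eigenvalues_def)
qed

lemma singular_values_selfadjoint:
  fixes P :: "real^'n^'n"
  assumes "selfadjoint ((*v) P)"
  shows "singular_values P = abs ` eigenvalues ((*v) P)"
proof -
  have "transpose P *v x = P *v x" for x
    using assms by (metis selfadjoint_def dot_lmul_matrix transpose_matrix_vector vector_eq_rdot)
  then have gram: "(transpose P ** P) *v x = P *v (P *v x)" for x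
    by (metis matrix_vector_mul_assoc)
  have "eigenvalues ((*v) (transpose P ** P)) = power2 ` eigenvalues ((*v) P)"
    by (rule eigenvalues_function_of_selfadjoint[OF assms])
      (simp_all only: gram matrix_vector_mul_linear matrix_vector_mult_scaleR
        scaleR_scaleR power2_eq_square)
  then show ?thesis
    by (simp add: singular_values_eq_sqrt_eigenvalues image_image)
qed

section \<open>The normalized Gram matrix\<close>

lemma normalized_gram_mult_vector:
  "normalized_gram A *v x = (1 / (norm A)\<^sup>2) *\<^sub>R ((transpose A ** A) *v x)"
  by (simp add: normalized_gram_def frob_norm_eq_norm scaleR_matrix_vector_assoc)

lemma selfadjoint_normalized_gram: "selfadjoint ((*v) (normalized_gram A))"
  using selfadjoint_gram[of A] by (simp add: selfadjoint_def normalized_gram_mult_vector)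

lemma finite_eigenvalues_normalized_gram: "finite (eigenvalues ((*v) (normalized_gram A)))"
  by (rule finite_eigenvalues_selfadjoint[OF selfadjoint_normalized_gram])

lemma eigenvalues_normalized_gram_nonempty: "eigenvalues ((*v) (normalized_gram A)) \<noteq> {}"
  by (rule eigenvalues_selfadjoint_nonempty[OF selfadjoint_normalized_gram])

lemma eigenvalues_normalized_gram:
  "eigenvalues ((*v) (normalized_gram A))
    = (\<lambda>\<mu>. \<mu> / (norm A)\<^sup>2) ` eigenvalues ((*v) (transpose A ** A))"
  by (rule eigenvalues_function_of_selfadjoint[OF selfadjoint_gram])
    (simp_all add: normalized_gram_mult_vector matrix_vector_mult_scaleR)

lemma eigenvalues_normalized_gram_subset: "eigenvalues ((*v) (normalized_gram A)) \<subseteq> {0..1}"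
  using eigenvalues_gram_subset[of A]
  by (auto simp: eigenvalues_normalized_gram divide_le_eq_1)

lemma zero_notin_eigenvalues_normalized_gram:
  fixes A :: "real^'n^'m"
  assumes "rank A = CARD('n)"
  shows "0 \<notin> eigenvalues ((*v) (normalized_gram A))"
proof
  assume "0 \<in> eigenvalues ((*v) (normalized_gram A))"
  then obtain v where "v \<noteq> 0" "A = 0 \<or> (transpose A ** A) *v v = 0"
    by (auto simp: eigenvalues_def normalized_gram_mult_vector)
  then have "A *v v = 0"
    using inner_gram[of A v v] by auto
  with \<open>v \<noteq> 0\<close> assms show False
    by (metis full_rank_injective injD matrix_vector_mult_0_right)
qed

lemma singular_values_eq_normalized_gram:
  assumes "A \<noteq> 0"
  shows "singular_values A = (\<lambda>\<mu>. norm A * sqrt \<mu>) ` eigenvalues ((*v) (normalized_gram A))"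
  using assms
  by (simp add: singular_values_eq_sqrt_eigenvalues eigenvalues_normalized_gram image_image
      real_sqrt_divide)

lemma mono_norm_mult_sqrt: "mono (\<lambda>\<mu>. norm A * sqrt \<mu>)"
  by (simp add: mono_def mult_left_mono)

lemma s_max_eq_Max_eigenvalues:
  assumes "A \<noteq> 0"
  shows "s_max A = Max (eigenvalues ((*v) (normalized_gram A)))" (is "_ = Max ?E")
proof -
  have "sigma_max A = norm A * sqrt (Max ?E)"
    unfolding sigma_max_def singular_values_eq_normalized_gram[OF assms]
    by (intro mono_Max_commute[symmetric] mono_norm_mult_sqrt
        finite_eigenvalues_normalized_gram eigenvalues_normalized_gram_nonempty)
  moreover have "Max ?E \<in> ?E"
    by (intro Max_in finite_eigenvalues_normalized_gram eigenvalues_normalized_gram_nonempty)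
  then have "0 \<le> Max ?E"
    using eigenvalues_normalized_gram_subset[of A] by auto
  ultimately show ?thesis
    using assms by (simp add: s_max_def frob_norm_eq_norm power_mult_distrib)
qed

lemma s_min_eq_Min_eigenvalues:
  fixes A :: "real^'n^'m"
  assumes "rank A = CARD('n)"
  shows "s_min A = Min (eigenvalues ((*v) (normalized_gram A)))" (is "_ = Min ?E")
proof -
  have "A \<noteq> 0"
    using assms by auto
  have "singular_values A - {0} = (\<lambda>\<mu>. norm A * sqrt \<mu>) ` ?E"
    using zero_notin_eigenvalues_normalized_gram[OF assms] \<open>A \<noteq> 0\<close>
    by (auto simp: singular_values_eq_normalized_gram)
  then have "sigma_min A = norm A * sqrt (Min ?E)"
    unfolding sigma_min_def
    by (simp add: mono_Min_commute[OF mono_norm_mult_sqrt]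
        finite_eigenvalues_normalized_gram eigenvalues_normalized_gram_nonempty)
  moreover have "Min ?E \<in> ?E"
    by (intro Min_in finite_eigenvalues_normalized_gram eigenvalues_normalized_gram_nonempty)
  then have "0 \<le> Min ?E"
    using eigenvalues_normalized_gram_subset[of A] by auto
  ultimately show ?thesis
    using \<open>A \<noteq> 0\<close> by (simp add: s_min_def frob_norm_eq_norm power_mult_distrib)
qed

lemma s_min_in_eigenvalues:
  fixes A :: "real^'n^'m"
  assumes "rank A = CARD('n)"
  shows "s_min A \<in> eigenvalues ((*v) (normalized_gram A))"
  unfolding s_min_eq_Min_eigenvalues[OF assms]
  by (intro Min_in finite_eigenvalues_normalized_gram eigenvalues_normalized_gram_nonempty)

lemma s_min_pos:
  fixes A :: "real^'n^'m"
  assumes "rank A = CARD('n)"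
  shows "0 < s_min A"
  using s_min_in_eigenvalues[OF assms] eigenvalues_normalized_gram_subset[of A]
    zero_notin_eigenvalues_normalized_gram[OF assms]
  by (auto simp: order_less_le)

lemma s_min_le_s_max:
  fixes A :: "real^'n^'m"
  assumes "rank A = CARD('n)"
  shows "s_min A \<le> s_max A"
proof -
  have "A \<noteq> 0"
    using assms by auto
  have "s_min A \<in> eigenvalues ((*v) (normalized_gram A))"
    by (rule s_min_in_eigenvalues[OF assms])
  then show ?thesis
    by (simp add: s_max_eq_Max_eigenvalues[OF \<open>A \<noteq> 0\<close>] finite_eigenvalues_normalized_gram)
qed

section \<open>The rate constant\<close>

definition eigen_rate :: "real \<Rightarrow> real \<Rightarrow> real \<Rightarrow> real"
  where "eigen_rate q \<alpha> s = (1 - \<alpha> * s)\<^sup>2 + \<alpha>\<^sup>2 / q * ((1 - s) * s)"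

lemma eigen_rate_nonneg: "q \<ge> 0 \<Longrightarrow> 0 \<le> s \<Longrightarrow> s \<le> 1 \<Longrightarrow> 0 \<le> eigen_rate q \<alpha> s"
  by (simp add: eigen_rate_def)

definition rate_matrix :: "real^'n^'n \<Rightarrow> real \<Rightarrow> real \<Rightarrow> real^'n^'n"
  where "rate_matrix G q \<alpha> = (mat 1 - \<alpha> *\<^sub>R G) ** (mat 1 - \<alpha> *\<^sub>R G)
    + (\<alpha>\<^sup>2 / q) *\<^sub>R ((mat 1 - G) ** G)"

lemma rate_matrix_mult_vector:
  "rate_matrix G q \<alpha> *v x
    = x - (2 * \<alpha>) *\<^sub>R (G *v x) + \<alpha>\<^sup>2 *\<^sub>R (G *v (G *v x))
      + (\<alpha>\<^sup>2 / q) *\<^sub>R (G *v x - G *v (G *v x))"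
  by (simp add: rate_matrix_def power2_eq_square algebra_simps
      flip: matrix_vector_mul_assoc scaleR_matrix_vector_assoc scaleR_2)

lemma selfadjoint_rate_matrix:
  assumes "selfadjoint ((*v) G)"
  shows "selfadjoint ((*v) (rate_matrix G q \<alpha>))"
  using assms
  by (simp add: selfadjoint_def rate_matrix_mult_vector inner_add_left inner_add_right
      inner_diff_left inner_diff_right)

lemma eigenvalues_rate_matrix:
  assumes "selfadjoint ((*v) G)"
  shows "eigenvalues ((*v) (rate_matrix G q \<alpha>)) = eigen_rate q \<alpha> ` eigenvalues ((*v) G)"
proof (rule eigenvalues_function_of_selfadjoint[OF assms])
  show "rate_matrix G q \<alpha> *v (G *v x) = G *v (rate_matrix G q \<alpha> *v x)" for x
    by (simp add: rate_matrix_mult_vector matrix_vector_right_distrib matrix_vector_mult_diff_distrib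
        matrix_vector_mult_scaleR)
  show "rate_matrix G q \<alpha> *v v = eigen_rate q \<alpha> \<mu> *\<^sub>R v" if "G *v v = \<mu> *\<^sub>R v" for v \<mu>
  proof -
    have "rate_matrix G q \<alpha> *v v
      = (1 - 2 * \<alpha> * \<mu> + \<alpha>\<^sup>2 * \<mu>\<^sup>2 + \<alpha>\<^sup>2 / q * (\<mu> - \<mu>\<^sup>2)) *\<^sub>R v"
      by (simp add: rate_matrix_mult_vector that matrix_vector_mult_scaleR scaleR_left_distrib
          scaleR_left_diff_distrib scaleR_right_diff_distrib right_diff_distrib
          diff_divide_distrib power2_eq_square mult.assoc)
    also have "1 - 2 * \<alpha> * \<mu> + \<alpha>\<^sup>2 * \<mu>\<^sup>2 + \<alpha>\<^sup>2 / q * (\<mu> - \<mu>\<^sup>2) = eigen_rate q \<alpha> \<mu>"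
      by (simp add: eigen_rate_def power2_eq_square algebra_simps)
    finally show ?thesis .
  qed
qed simp

lemma rka_rate_eq_Max_eigen_rate:
  "rka_rate A q \<alpha> = Max (eigen_rate (real q) \<alpha> ` eigenvalues ((*v) (normalized_gram A)))"
proof -
  let ?P = "rate_matrix (normalized_gram A) (real q) \<alpha>"
  let ?H = "eigen_rate (real q) \<alpha> ` eigenvalues ((*v) (normalized_gram A))"
  have "singular_values ?P = abs ` eigenvalues ((*v) ?P)"
    by (intro singular_values_selfadjoint selfadjoint_rate_matrix selfadjoint_normalized_gram)
  also have "\<dots> = abs ` ?H"
    by (simp only: eigenvalues_rate_matrix selfadjoint_normalized_gram)
  also have "\<dots> = ?H"
    using eigenvalues_normalized_gram_subset[of A]
    by (force simp: image_image eigen_rate_nonneg intro!: image_cong)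
  finally show ?thesis
    by (simp add: rka_rate_def rate_matrix_def sigma_max_def Let_def)
qed

lemma convex_on_eigen_rate:
  assumes "q \<ge> 1" "convex S"
  shows "convex_on S (eigen_rate q \<alpha>)"
proof (rule f''_ge0_imp_convex)
  have "q \<noteq> 0" using assms by simp
  then show "(eigen_rate q \<alpha> has_real_derivative
      - 2 * \<alpha> * (1 - \<alpha> * s) + \<alpha>\<^sup>2 / q * (1 - 2 * s)) (at s)" for s
    unfolding eigen_rate_def [abs_def]
    by (auto intro!: derivative_eq_intros simp: field_simps)
  show "((\<lambda>s. - 2 * \<alpha> * (1 - \<alpha> * s) + \<alpha>\<^sup>2 / q * (1 - 2 * s)) has_real_derivative
      2 * (\<alpha>\<^sup>2 - \<alpha>\<^sup>2 / q)) (at s)" for s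
    using \<open>q \<noteq> 0\<close>
    by (auto intro!: derivative_eq_intros simp: algebra_simps power2_eq_square)
  show "0 \<le> 2 * (\<alpha>\<^sup>2 - \<alpha>\<^sup>2 / q)"
    using divide_left_mono[of 1 q "\<alpha>\<^sup>2"] assms by simp
qed fact

lemma Max_image_convex_on:
  fixes f :: "real \<Rightarrow> real"
  assumes "finite S" "S \<noteq> {}" "convex_on {Min S..Max S} f"
  shows "Max (f ` S) = max (f (Min S)) (f (Max S))"
proof (rule Max_eqI)
  show "y \<le> max (f (Min S)) (f (Max S))" if "y \<in> f ` S" for y
    using that assms by (auto intro: convex_on_le_max)
  show "max (f (Min S)) (f (Max S)) \<in> f ` S"
    using assms by (simp add: max_def)
qed (simp add: assms)

lemma rka_rate_eq_max_s_min_s_max: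
  fixes A :: "real^'n^'m"
  assumes "rank A = CARD('n)" "q \<ge> 1"
  shows "rka_rate A q \<alpha> = max (eigen_rate (real q) \<alpha> (s_min A)) (eigen_rate (real q) \<alpha> (s_max A))"
proof -
  have "A \<noteq> 0"
    using assms(1) by auto
  then show ?thesis
    using assms(2)
    by (simp add: rka_rate_eq_Max_eigen_rate Max_image_convex_on convex_on_eigen_rate
        finite_eigenvalues_normalized_gram eigenvalues_normalized_gram_nonempty
        s_min_eq_Min_eigenvalues[OF assms(1)] s_max_eq_Max_eigenvalues)
qed

section \<open>Optimizing the relaxation parameter\<close>

definition rate_vertex :: "real \<Rightarrow> real \<Rightarrow> real"
  where "rate_vertex q s = q / (1 + (q - 1) * s)"

definition rate_crossing :: "real \<Rightarrow> real \<Rightarrow> real \<Rightarrow> real"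
  where "rate_crossing q a b = 2 * q / (1 + (q - 1) * (a + b))"

lemma rate_vertex_pos: "q \<ge> 1 \<Longrightarrow> s \<ge> 0 \<Longrightarrow> rate_vertex q s > 0"
  by (simp add: rate_vertex_def add_pos_nonneg)

lemma rate_crossing_pos: "q \<ge> 1 \<Longrightarrow> a \<ge> 0 \<Longrightarrow> b \<ge> 0 \<Longrightarrow> rate_crossing q a b > 0"
  by (simp add: rate_crossing_def add_pos_nonneg)

lemma rate_vertex_le_crossing_iff:
  assumes "q \<ge> 1" "a \<ge> 0" "b \<ge> 0"
  shows "rate_vertex q a \<le> rate_crossing q a b \<longleftrightarrow> 0 \<le> 1 - (q - 1) * (b - a)"
proof -
  have "1 + (q - 1) * a > 0" "1 + (q - 1) * (a + b) > 0"
    using assms by (auto intro!: add_pos_nonneg)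
  then have "rate_vertex q a \<le> rate_crossing q a b
      \<longleftrightarrow> q * (1 + (q - 1) * (a + b)) \<le> q * (2 * (1 + (q - 1) * a))"
    unfolding rate_vertex_def rate_crossing_def
    by (simp add: divide_le_eq le_divide_eq mult_ac)
  also have "\<dots> \<longleftrightarrow> 1 + (q - 1) * (a + b) \<le> 2 * (1 + (q - 1) * a)"
    using assms(1) by simp
  also have "\<dots> \<longleftrightarrow> 0 \<le> 1 - (q - 1) * (b - a)"
    by (simp add: algebra_simps)
  finally show ?thesis .
qed

lemma rate_crossing_commute: "rate_crossing q a b = rate_crossing q b a"
  by (simp add: rate_crossing_def add.commute)

lemma eigen_rate_vertex_form:
  assumes "q \<ge> 1" "s \<ge> 0"
  shows "eigen_rate q \<alpha> s
    = 1 - s * rate_vertex q s + s / rate_vertex q s * (\<alpha> - rate_vertex q s)\<^sup>2"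
proof -
  have "eigen_rate q \<alpha> s = 1 - 2 * s * \<alpha> + s / rate_vertex q s * \<alpha>\<^sup>2"
    using assms(1)
    by (simp add: eigen_rate_def rate_vertex_def power2_eq_square field_simps)
  also have "\<dots> = 1 - s * rate_vertex q s + s / rate_vertex q s * (\<alpha> - rate_vertex q s)\<^sup>2"
    using rate_vertex_pos[OF assms] by (simp add: power2_eq_square field_simps)
  finally show ?thesis .
qed

lemma eigen_rate_less_iff:
  assumes "q \<ge> 1" "s > 0"
  shows "eigen_rate q \<alpha> s < eigen_rate q \<beta> s
    \<longleftrightarrow> \<bar>\<alpha> - rate_vertex q s\<bar> < \<bar>\<beta> - rate_vertex q s\<bar>"
proof -
  have "s / rate_vertex q s > 0"
    using assms rate_vertex_pos[of q s] by simp
  then have "eigen_rate q \<alpha> s < eigen_rate q \<beta> s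
      \<longleftrightarrow> (\<alpha> - rate_vertex q s)\<^sup>2 < (\<beta> - rate_vertex q s)\<^sup>2"
    using assms by (simp only: eigen_rate_vertex_form order_less_imp_le add_less_cancel_left
        mult_less_cancel_left_pos)
  also have "\<dots> \<longleftrightarrow> \<bar>\<alpha> - rate_vertex q s\<bar> < \<bar>\<beta> - rate_vertex q s\<bar>"
    by (simp add: abs_le_square_iff flip: not_le)
  finally show ?thesis .
qed

lemma eigen_rate_diff:
  assumes "q \<ge> 1"
  shows "eigen_rate q \<alpha> b - eigen_rate q \<alpha> a
    = 2 * (b - a) * \<alpha> * (\<alpha> / rate_crossing q a b - 1)"
  using assms by (simp add: eigen_rate_def rate_crossing_def power2_eq_square field_simps)

lemma max_eigen_rate_less_if_neq_optimum:
  fixes q a b :: real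
  assumes q: "q \<ge> 1" and "0 < a" "a \<le> b"
  defines "\<alpha> \<equiv> min (rate_vertex q a) (rate_crossing q a b)"
  assumes "\<beta> \<noteq> \<alpha>"
  shows "max (eigen_rate q \<alpha> a) (eigen_rate q \<alpha> b) < max (eigen_rate q \<beta> a) (eigen_rate q \<beta> b)"
proof -
  have "0 < \<alpha>" "\<alpha> \<le> rate_crossing q a b"
    using assms rate_vertex_pos[of q a] rate_crossing_pos[of q a b] by simp_all
  then have "\<alpha> / rate_crossing q a b \<le> 1"
    by simp
  then have "eigen_rate q \<alpha> b - eigen_rate q \<alpha> a \<le> 0"
    unfolding eigen_rate_diff[OF q] using \<open>a \<le> b\<close> \<open>0 < \<alpha>\<close> by (intro mult_nonneg_nonpos) auto
  then have "max (eigen_rate q \<alpha> a) (eigen_rate q \<alpha> b) = eigen_rate q \<alpha> a"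
    by simp
  also have "\<dots> < max (eigen_rate q \<beta> a) (eigen_rate q \<beta> b)"
  proof (cases "\<alpha> = rate_vertex q a \<or> \<beta> < \<alpha>")
    case True
    then have "eigen_rate q \<alpha> a < eigen_rate q \<beta> a"
      using eigen_rate_less_iff[OF q \<open>0 < a\<close>] \<open>\<beta> \<noteq> \<alpha>\<close> by (auto simp: \<alpha>_def)
    then show ?thesis by simp
  next
    case False
    then have crossing: "\<alpha> = rate_crossing q a b" and "\<alpha> < \<beta>"
      using \<open>\<beta> \<noteq> \<alpha>\<close> by (auto simp: \<alpha>_def min_def split: if_splits)
    have "rate_vertex q b \<le> \<alpha>"
      using rate_vertex_le_crossing_iff[of q b a] q \<open>0 < a\<close> \<open>a \<le> b\<close>
        mult_nonneg_nonneg[of "q - 1" "b - a"]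
      by (simp add: crossing rate_crossing_commute algebra_simps)
    then have "eigen_rate q \<alpha> b < eigen_rate q \<beta> b"
      using eigen_rate_less_iff[OF q, of b] \<open>\<alpha> < \<beta>\<close> \<open>0 < a\<close> \<open>a \<le> b\<close> by simp
    moreover have "eigen_rate q \<alpha> b = eigen_rate q \<alpha> a"
      using eigen_rate_diff[OF q, of \<alpha> b a] crossing \<open>0 < \<alpha>\<close> by simp
    ultimately show ?thesis by simp
  qed
  finally show ?thesis .
qed

lemma Collect_is_arg_min_eq_singleton:
  fixes f :: "'a \<Rightarrow> 'b::order"
  assumes "P x" "\<And>y. P y \<Longrightarrow> y \<noteq> x \<Longrightarrow> f x < f y"
  shows "{y. is_arg_min f P y} = {x}"
proof (intro set_eqI iffI)
  show "y \<in> {x}" if "y \<in> {y. is_arg_min f P y}" for y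
    using that assms by (auto simp: is_arg_min_def)
  have "\<not> f y < f x" if "P y" for y
    using assms(2)[OF that] less_asym by (cases "y = x") auto
  then show "y \<in> {y. is_arg_min f P y}" if "y \<in> {x}" for y
    using that \<open>P x\<close> by (auto simp: is_arg_min_def)
qed

theorem theorem2:
  fixes A :: "real^'n^'m" and q :: nat
  assumes "CARD('m) \<ge> CARD('n)"
    and "rank A = CARD('n)"
    and "\<And>i. row i A \<noteq> 0"
    and "q \<ge> 1"
  shows "{\<alpha>. is_arg_min (rka_rate A q) (\<lambda>\<alpha>. \<alpha> > 0) \<alpha>} =
    {if 1 - (real q - 1) * (s_max A - s_min A) \<ge> 0
     then real q / (1 + (real q - 1) * s_min A)
     else 2 * real q / (1 + (real q - 1) * (s_min A + s_max A))}"
proof -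
  have q: "real q \<ge> 1" and s: "0 < s_min A" "s_min A \<le> s_max A"
    using assms by (simp_all add: s_min_pos s_min_le_s_max)
  let ?\<alpha> = "min (rate_vertex q (s_min A)) (rate_crossing q (s_min A) (s_max A))"
  have "{\<alpha>. is_arg_min (rka_rate A q) (\<lambda>\<alpha>. \<alpha> > 0) \<alpha>} = {?\<alpha>}"
  proof (rule Collect_is_arg_min_eq_singleton)
    show "?\<alpha> > 0"
      using q s by (simp add: rate_vertex_pos rate_crossing_pos)
    show "rka_rate A q ?\<alpha> < rka_rate A q \<beta>" if "\<beta> \<noteq> ?\<alpha>" for \<beta>
      unfolding rka_rate_eq_max_s_min_s_max[OF assms(2,4)]
      by (rule max_eigen_rate_less_if_neq_optimum[OF q s that])
  qed
  also have "?\<alpha> = (if 1 - (real q - 1) * (s_max A - s_min A) \<ge> 0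
      then rate_vertex q (s_min A) else rate_crossing q (s_min A) (s_max A))"
    using q s by (simp add: min_def rate_vertex_le_crossing_iff)
  finally show ?thesis
    unfolding rate_vertex_def rate_crossing_def .
qed

end
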